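(* There exists a complete bifurcate tree over an alphabet of size $12$.
   Context: A square is a nonempty word of the form $XX$; a word is square-free if it has no (contiguous) factor that is a square. For a word $W$ of length $n$ and $0\le i\le n$, let $P_i(W)$, $S_i(W)$ be the prefix and suffix of $W$ of length $i$; an extension of $W$ at position $i$ over alphabet $\mathcal{A}$ is a word $P_i(W)\mathtt{x}S_{n-i}(W)$ with $\mathtt{x}\in\mathcal{A}$. A square-free word of length $n$ is bifurcate over $\mathcal{A}$ if for each position $i\in\{0,\dots,n\}$ it has a square-free extension at position $i$. A bifurcate tree over $\mathcal{A}$ is a family of bifurcate words over $\mathcal{A}$ arranged as a rooted tree in which the children (descendants) of a word $W$ are single-letter extensions of $W$ at pairwise different positions; thus a word of length $n$ has at most $n+1$ children. A bifurcate tree is complete if every word of length $n$ in it has exactly $n+1$ children (one extension at each position $0,\dots,n$); such a tree is necessarily infinite. *)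

theory Defs
  imports Main
begin

definition square_free :: "'a list \<Rightarrow> bool" where
  "square_free w \<longleftrightarrow> \<not> (\<exists>u x v. x \<noteq> [] \<and> w = u @ x @ x @ v)"

definition ext_at :: "'a list \<Rightarrow> nat \<Rightarrow> 'a \<Rightarrow> 'a list" where
  "ext_at W i c = take i W @ [c] @ drop i W"

definition bifurcate :: "'a set \<Rightarrow> 'a list \<Rightarrow> bool" where
  "bifurcate A W \<longleftrightarrow> set W \<subseteq> A \<and> square_free W \<and>
     (\<forall>i \<le> length W. \<exists>c\<in>A. square_free (ext_at W i c))"

text \<open>Nodes of a complete tree are addressed by the list of insertion positions chosen
  along the path from the root. If the root has length r, the j-th step (0-based) acts on a
  word of length r + j, so positions 0..r+j are available.\<close>
definition valid_path :: "nat \<Rightarrow> nat list \<Rightarrow> bool" where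
  "valid_path r p \<longleftrightarrow> (\<forall>j < length p. p ! j \<le> r + j)"

text \<open>T labels every node (path) by a word; T [] is the root. Complete bifurcate tree:
  every node is a bifurcate word over A, and the child of node p reached by position i
  is an extension of T p at position i, for every i = 0..|T p|.\<close>
definition complete_bifurcate_tree :: "'a set \<Rightarrow> (nat list \<Rightarrow> 'a list) \<Rightarrow> bool" where
  "complete_bifurcate_tree A T \<longleftrightarrow>
     (\<forall>p. valid_path (length (T [])) p \<longrightarrow> bifurcate A (T p)) \<and>
     (\<forall>p i. valid_path (length (T [])) p \<and> i \<le> length (T p) \<longrightarrow>
        (\<exists>c\<in>A. T (p @ [i]) = ext_at (T p) i c))"

end

theory Submission
  imports Defs
begin

text \<open>Every letter is a vertex of an infinite outerplanar graph and carries a level and an index.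
  A letter inserted between two letters of equal level starts a new layer one level above them;
  otherwise it prolongs the layer of the higher neighbour by one index. Colouring a vertex with one
  of four letters chosen by its level and one of three letters chosen by its index follows the
  nonrepetitive 12-colouring of outerplanar graphs by Kuendgen and Pelsmajer. The levels along a
  word form a walk on the integers. Since the level colours form a square-free sequence without
  palindromes, the two halves of a square visit equal levels. The letters of minimal level in
  the square then have consecutive indices, so they yield a square in the square-free ternary
  sequence of index colours.\<close>

section \<open>Two-sided square-free sequences on three and four letters\<close>

definition square_free_seq :: "(int \<Rightarrow> 'a) \<Rightarrow> bool" where
  "square_free_seq f \<longleftrightarrow> (\<forall>a p. 0 < p \<longrightarrow> (\<exists>i\<in>{a..<a + p}. f i \<noteq> f (i + p)))"

lemma square_free_seqD:
  assumes "square_free_seq f" "0 < p"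
  obtains i where "a \<le> i" "i < a + p" "f i \<noteq> f (i + p)"
  using assms unfolding square_free_seq_def by fastforce

text \<open>The Thue-Morse sequence continued to the negative integers. Halving fixes the odd number
  -1, so a plain recursion would demand a value at -1 that differs from itself. Flipping
  \<open>b\<close>, the value at -1, at each halving avoids this.\<close>

function thue_morse :: "bool \<Rightarrow> int \<Rightarrow> bool" where
  "thue_morse b n =
     (if n = 0 then False else if n = -1 then b else thue_morse (\<not> b) (n div 2) \<noteq> odd n)"
  by auto
termination by (relation "measure (\<lambda>(b, n). nat \<bar>n\<bar>)") auto

declare thue_morse.simps [simp del]

lemma thue_morse_double: "thue_morse b (2 * n) = thue_morse (\<not> b) n"
  by (subst thue_morse.simps) (auto simp: thue_morse.simps[of _ 0] split: if_splits)

lemma thue_morse_double_Suc: "thue_morse b (2 * n + 1) = (\<not> thue_morse (\<not> b) n)"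
proof -
  have "2 * n + 1 \<noteq> 0" "2 * n + 1 = -1 \<longleftrightarrow> n = -1" "(2 * n + 1) div 2 = n"
    by presburger+
  then show ?thesis
    by (subst thue_morse.simps) (simp add: thue_morse.simps[of _ "-1"])
qed

lemma thue_morse_succ: "even n \<Longrightarrow> thue_morse b (n + 1) \<noteq> thue_morse b n"
  by (auto simp: thue_morse_double thue_morse_double_Suc elim!: evenE)

text \<open>An overlap of even period, restricted to the positions of one parity, gives an overlap
  of half the period. If the period is odd, one of \<open>i\<close> and \<open>i + p\<close> is
  even, so adjacent letters differ throughout; alternation over the odd distance \<open>p\<close>
  then contradicts the period.\<close>

lemma thue_morse_overlap_free:
  assumes "0 < p"
  shows "\<exists>i\<in>{a..a + p}. thue_morse b i \<noteq> thue_morse b (i + p)"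
  using assms
proof (induction "nat p" arbitrary: p a b rule: less_induct)
  case less
  show ?case
  proof (rule ccontr)
    assume "\<not> ?thesis"
    then have per: "thue_morse b i = thue_morse b (i + p)" if "a \<le> i" "i \<le> a + p" for i
      using that by auto
    show False
    proof (cases "even p")
      case True
      then obtain q where q: "p = 2 * q" by (elim evenE)
      have "\<exists>i\<in>{a div 2..a div 2 + q}. thue_morse (\<not> b) i \<noteq> thue_morse (\<not> b) (i + q)"
        using less.prems q by (intro less.hyps) auto
      then obtain i where i: "a div 2 \<le> i" "i \<le> a div 2 + q"
          "thue_morse (\<not> b) i \<noteq> thue_morse (\<not> b) (i + q)"
        unfolding Bex_def atLeastAtMost_iff by blast
      show False
      proof (cases "even a")
        case True
        then have "a \<le> 2 * i" "2 * i \<le> a + p" using i q by auto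
        from per[OF this] show False
          using i(3) thue_morse_double[of b i] thue_morse_double[of b "i + q"]
          by (simp add: q distrib_left)
      next
        case False
        then have "a \<le> 2 * i + 1" "2 * i + 1 \<le> a + p" using i q by presburger+
        from per[OF this] show False
          using i(3) thue_morse_double_Suc[of b i] thue_morse_double_Suc[of b "i + q"]
          by (simp add: q distrib_left add_ac)
      qed
    next
      case False
      have step: "thue_morse b (i + 1) \<noteq> thue_morse b i" if "a \<le> i" "i < a + p" for i
      proof (cases "even i")
        case False
        then have "even (i + p)" using \<open>odd p\<close> by simp
        from thue_morse_succ[OF this, of b] show ?thesis
          using per[of i] per[of "i + 1"] that by (simp add: add_ac)
      qed (rule thue_morse_succ)
      have "int k \<le> p \<Longrightarrow> thue_morse b (a + int k) \<longleftrightarrow> (thue_morse b a \<longleftrightarrow> even k)" for k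
      proof (induction k)
        case (Suc k)
        then show ?case using step[of "a + int k"] by (auto simp: add_ac)
      qed simp
      from this[of "nat p"] have "thue_morse b (a + p) \<noteq> thue_morse b a"
        using less.prems False by (simp add: even_nat_iff)
      then show False using per[of a] less.prems by simp
    qed
  qed
qed

text \<open>The three values encode the differences 0, -1 and 1 of consecutive Thue-Morse
  letters.\<close>

definition ternary :: "int \<Rightarrow> nat" where
  "ternary n = (if thue_morse False n = thue_morse False (n + 1) then 0
     else if thue_morse False n then 1 else 2)"

lemma ternary_less: "ternary n < 3"
  by (simp add: ternary_def)

lemma square_free_ternary: "square_free_seq ternary"
  unfolding square_free_seq_def
proof (intro allI impI, rule ccontr)
  fix a p :: int
  assume p: "0 < p" and "\<not> (\<exists>i\<in>{a..<a + p}. ternary i \<noteq> ternary (i + p))"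
  then have per: "ternary i = ternary (i + p)" if "a \<le> i" "i < a + p" for i
    using that by auto
  let ?t = "\<lambda>i. of_bool (thue_morse False i) :: int"
  have step: "?t (i + 1) - ?t i = ?t (i + p + 1) - ?t (i + p)" if "a \<le> i" "i < a + p" for i
    using per[OF that] by (auto simp: ternary_def split: if_splits)
  \<comment> \<open>The offset over distance \<open>p\<close> is constant on the block. Applied
    twice it leads from \<open>a\<close> to \<open>a + 2 * p\<close>, and the values 0 and 1 leave
    room only for the offset 0; the square of differences then comes from an overlap.\<close>
  have diff: "?t (a + int k + p) - ?t (a + int k) = ?t (a + p) - ?t a" if "int k \<le> p" for k
    using that
  proof (induction k)
    case (Suc k)
    then show ?case using step[of "a + int k"] by (simp add: add_ac)
  qed simp
  from diff[of "nat p"] p have "?t (a + p) = ?t a"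
    by (auto simp: of_bool_def split: if_splits)
  then have "thue_morse False (a + int k) = thue_morse False (a + int k + p)" if "int k \<le> p" for k
    using diff[OF that] by (auto simp: of_bool_def split: if_splits)
  then have "thue_morse False i = thue_morse False (i + p)" if "i \<in> {a..a + p}" for i
    using that by (metis add.commute add_le_cancel_left atLeastAtMost_iff zle_iff_zadd)
  then show False using thue_morse_overlap_free[OF p, of a False] by blast
qed

lemma ternary_succ: "ternary (n + 1) \<noteq> ternary n"
proof -
  obtain i where "n \<le> i" "i < n + 1" "ternary i \<noteq> ternary (i + 1)"
    using square_free_seqD[OF square_free_ternary, of 1 n] by auto
  moreover from this have "i = n" by simp
  ultimately show ?thesis by simp
qed

text \<open>The marker 3 between consecutive pairs of ternary letters destroys all palindromes.\<close>

definition marked :: "int \<Rightarrow> nat" where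
  "marked n = (if n mod 3 = 2 then 3 else ternary (2 * (n div 3) + n mod 3))"

lemma marked_less: "marked n < 4"
  using ternary_less[of "2 * (n div 3) + n mod 3"] by (simp add: marked_def)

lemma marked_eq_3_iff: "marked n = 3 \<longleftrightarrow> n mod 3 = 2"
  using ternary_less[of "2 * (n div 3) + n mod 3"] by (simp add: marked_def)

lemma marked_cases:
  fixes n :: int
  obtains m where "n = 3 * m" | m where "n = 3 * m + 1" | m where "n = 3 * m + 2"
proof -
  have "n = 3 * (n div 3) \<or> n = 3 * (n div 3) + 1 \<or> n = 3 * (n div 3) + 2" by presburger
  then show thesis using that by blast
qed

lemma marked_simps:
  "marked (3 * m) = ternary (2 * m)"
  "marked (3 * m + 1) = ternary (2 * m + 1)"
  "marked (3 * m + 2) = 3"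
proof -
  have "(3 * m + 1) div 3 = m" "(3 * m + 2) mod 3 = 2" "(3 * m + 1) mod 3 = 1" by presburger+
  then show "marked (3 * m) = ternary (2 * m)"
    "marked (3 * m + 1) = ternary (2 * m + 1)" "marked (3 * m + 2) = 3"
    by (simp_all add: marked_def)
qed

text \<open>Any three consecutive positions carry the marker once and two ternary letters of
  consecutive indices.\<close>

lemma marked_distinct: "marked (n + 1) \<noteq> marked n" "marked (n + 2) \<noteq> marked n"
proof -
  have n3: "ternary k \<noteq> 3" "3 \<noteq> ternary k" for k using ternary_less[of k] by auto
  show "marked (n + 1) \<noteq> marked n"
  proof (cases n rule: marked_cases)
    case (1 m)
    then show ?thesis using ternary_succ[of "2 * m"] by (simp add: marked_simps)
  next
    case (2 m)
    then have "marked (n + 1) = 3" using marked_simps(3)[of m] by (simp add: add_ac)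
    then show ?thesis using 2 by (simp add: marked_simps n3)
  next
    case (3 m)
    then have "marked (n + 1) = ternary (2 * m + 2)"
      using marked_simps(1)[of "m + 1"] by (simp add: add_ac)
    then show ?thesis using 3 by (simp only: marked_simps n3 not_False_eq_True)
  qed
  show "marked (n + 2) \<noteq> marked n"
  proof (cases n rule: marked_cases)
    case (2 m)
    then have "marked (n + 2) = ternary (2 * m + 2)"
      using marked_simps(1)[of "m + 1"] by (simp add: add_ac)
    moreover have "ternary (2 * m + 2) \<noteq> ternary (2 * m + 1)"
      using ternary_succ[of "2 * m + 1"] by (simp add: add_ac)
    ultimately show ?thesis using 2 marked_simps(2) by metis
  next
    case (3 m)
    then have "marked (n + 2) = ternary (2 * m + 3)"
      using marked_simps(2)[of "m + 1"] by (simp add: add_ac)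
    then show ?thesis using 3 by (simp add: marked_simps n3)
  qed (simp add: marked_simps n3)
qed

lemma marked_neighbours:
  assumes "\<bar>x - y\<bar> \<le> 2" "marked x = marked y"
  shows "x = y"
proof (rule ccontr)
  assume "x \<noteq> y"
  with assms(1) have "x = y + 1 \<or> x = y + 2 \<or> y = x + 1 \<or> y = x + 2" by arith
  then show False using assms(2) marked_distinct[of x] marked_distinct[of y] by auto
qed

lemma square_free_marked: "square_free_seq marked"
  unfolding square_free_seq_def
proof (intro allI impI, rule ccontr)
  fix a p :: int
  assume p: "0 < p" and "\<not> (\<exists>i\<in>{a..<a + p}. marked i \<noteq> marked (i + p))"
  then have per: "marked i = marked (i + p)" if "a \<le> i" "i < a + p" for i
    using that by auto
  have "\<not> p \<le> 2"
    using per[of a] p marked_neighbours[of a "a + p"] by auto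
  moreover obtain i where i: "a \<le> i" "i < a + 3" "i mod 3 = 2"
  proof
    \<comment> \<open>The first marker position from \<open>a\<close> on. The period takes it to
      another marker, so 3 divides \<open>p\<close>.\<close>
    show "a \<le> a + (2 - a) mod 3" "a + (2 - a) mod 3 < a + 3" by simp_all
    show "(a + (2 - a) mod 3) mod 3 = 2" by presburger
  qed
  ultimately have "(i + p) mod 3 = 2"
    using per[of i] by (simp flip: marked_eq_3_iff)
  then obtain q where q: "p = 3 * q"
    using i(3) that[of "p div 3"] by (metis add_diff_cancel_left' diff_self dvd_mult_div_cancel
        mod_0_imp_dvd mod_diff_eq mod_0)
  \<comment> \<open>The index of the first ternary letter at or after position \<open>a\<close>.
    Erasing the markers turns the period \<open>3 * q\<close> into \<open>2 * q\<close>.\<close>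
  define a' where "a' = 2 * (a div 3) + a mod 3"
  obtain j where j: "a' \<le> j" "j < a' + 2 * q" "ternary j \<noteq> ternary (j + 2 * q)"
    using square_free_seqD[OF square_free_ternary, of "2 * q" a'] p q by auto
  define i where "i = 3 * (j div 2) + j mod 2"
  have m: "marked (3 * (k div 2) + k mod 2) = ternary k" for k
    by (cases "even k") (auto simp: marked_simps elim!: evenE oddE)
  have "(j + 2 * q) div 2 = j div 2 + q" "(j + 2 * q) mod 2 = j mod 2" by simp_all
  then have "marked (i + p) = ternary (j + 2 * q)"
    using m[of "j + 2 * q"] by (simp add: i_def q distrib_left add_ac)
  moreover have "marked i = ternary j" using m[of j] by (simp add: i_def)
  moreover have "a \<le> i" "i < a + p"
    using j(1,2) unfolding i_def a'_def q by presburger+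
  ultimately show False using per[of i] j(3) by simp
qed

section \<open>Walks on the integers read through \<open>marked\<close>\<close>

lemma walk_intermediate_value:
  fixes L :: "nat \<Rightarrow> int"
  assumes step: "\<And>i. i < n \<Longrightarrow> \<bar>L (Suc i) - L i\<bar> \<le> 1"
    and "i \<le> n" "j \<le> n" "L i \<le> k" "k \<le> L j"
  obtains m where "m \<le> n" "L m = k"
proof (cases "i \<le> j")
  case True
  have "\<exists>m. i \<le> m \<and> m \<le> j \<and> L m = k"
    using assms True by (intro nat_intermed_int_val) auto
  then show ?thesis using assms(3) that le_trans by blast
next
  case False
  have "\<bar>- L (Suc l) - - L l\<bar> \<le> 1" if "l < n" for l
    using step[OF that] by simp
  then have "\<exists>m. j \<le> m \<and> m \<le> i \<and> - L m = - k"
    using assms(2-) False by (intro nat_intermed_int_val) auto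
  then show ?thesis using assms(2) that le_trans by (metis neg_equal_iff_equal)
qed

text \<open>Any three consecutive values of \<open>marked\<close> are distinct, so the letters determine
  the walk up to a translation or a reflection of the integers.\<close>

lemma marked_walk_isometry:
  fixes L M :: "nat \<Rightarrow> int"
  assumes "\<And>i. i < n \<Longrightarrow> \<bar>L (Suc i) - L i\<bar> \<le> 1"
    and "\<And>i. i < n \<Longrightarrow> \<bar>M (Suc i) - M i\<bar> \<le> 1"
    and "\<And>i. i \<le> n \<Longrightarrow> marked (L i) = marked (M i)"
  shows "\<exists>e\<in>{1, -1}. \<forall>i\<le>n. M i - M 0 = e * (L i - L 0)"
  using assms
proof (induction n)
  case 0
  show ?case by (intro bexI[of _ 1]) auto
next
  case (Suc n)
  obtain e where e: "e \<in> {1, -1}" and iso: "\<And>i. i \<le> n \<Longrightarrow> M i - M 0 = e * (L i - L 0)"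
    using Suc.IH Suc.prems by (metis less_SucI le_SucI)
  have L: "\<bar>L (Suc n) - L n\<bar> \<le> 1" and M: "\<bar>M (Suc n) - M n\<bar> \<le> 1"
    and eq: "marked (L n) = marked (M n)" "marked (L (Suc n)) = marked (M (Suc n))"
    using Suc.prems by auto
  show ?case
  proof (cases "\<exists>i\<le>n. L i \<noteq> L n")
    \<comment> \<open>While \<open>L\<close> has stayed on one level the sign is still free, and the
      next step alone chooses it.\<close>
    case False
    then have "\<And>i. i \<le> n \<Longrightarrow> L i = L 0" by (metis le0)
    moreover have "M i = M 0" if "i \<le> n" for i
      using iso[OF that] calculation[OF that] by simp
    ultimately have const: "\<And>i. i \<le> n \<Longrightarrow> L i = L 0 \<and> M i = M 0" by blast
    have "L (Suc n) = L n \<longleftrightarrow> M (Suc n) = M n"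
      using L M eq by (intro iffI; intro marked_neighbours) simp_all
    then have "M (Suc n) - M n = L (Suc n) - L n \<or> M (Suc n) - M n = - (L (Suc n) - L n)"
      using L M by linarith
    then obtain e' :: int where e': "e' \<in> {1, -1}" "M (Suc n) - M n = e' * (L (Suc n) - L n)"
      using that[of 1] that[of "-1"] by (elim disjE) simp_all
    have "M i - M 0 = e' * (L i - L 0)" if "i \<le> Suc n" for i
      using that e'(2) const[of i] const[of n] by (cases "i = Suc n") simp_all
    then show ?thesis using e'(1) by blast
  next
    case True
    then obtain j where j: "j \<le> n" "L j \<noteq> L n" by blast
    \<comment> \<open>The walk has already visited a level \<open>L n + d\<close> next to
      \<open>L n\<close>. The value of \<open>marked\<close> there agrees with the one at
      \<open>M n + e * d\<close>, which tells the possible next levels apart.\<close>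
    obtain d i where i: "i \<le> n" "L i = L n + d" "d \<in> {1, -1}"
    proof (cases "L j < L n")
      case True
      obtain i where "i \<le> n" "L i = L n - 1"
        by (rule walk_intermediate_value[of n L j n "L n - 1"]) (use Suc.prems(1) j True in auto)
      then show thesis using that[of i "-1"] by simp
    next
      case False
      obtain i where "i \<le> n" "L i = L n + 1"
        by (rule walk_intermediate_value[of n L n j "L n + 1"]) (use Suc.prems(1) j False in auto)
      then show thesis using that[of i 1] by simp
    qed
    have "M i = M n + e * d"
      using iso[of i] iso[of n] i by (simp add: algebra_simps)
    then have nb: "marked (L n + d) = marked (M n + e * d)"
      using Suc.prems(3)[of i] i by simp
    have L3: "L (Suc n) = L n \<or> L (Suc n) = L n + d \<or> L (Suc n) = L n - d"
      and M3: "M (Suc n) = M n \<or> M (Suc n) = M n + e * d \<or> M (Suc n) = M n - e * d"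
      using L M i(3) e by auto
    have "M (Suc n) - M n = e * (L (Suc n) - L n)"
      using L3
    proof (elim disjE)
      assume *: "L (Suc n) = L n"
      then have "M (Suc n) = M n"
        using M eq by (intro marked_neighbours) auto
      then show ?thesis using * by simp
    next
      assume *: "L (Suc n) = L n + d"
      then have "M (Suc n) = M n + e * d"
        using M3 eq nb i(3) e by (intro marked_neighbours) auto
      then show ?thesis using * by simp
    next
      assume *: "L (Suc n) = L n - d"
      have "M (Suc n) \<noteq> M n"
        using * eq marked_neighbours[of "L n - d" "L n"] i(3) by auto
      moreover have "M (Suc n) \<noteq> M n + e * d"
        using * eq nb marked_neighbours[of "L n - d" "L n + d"] i(3) by auto
      ultimately show ?thesis using * M3 by auto
    qed
    then have "M (Suc n) - M 0 = e * (L (Suc n) - L 0)"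
      using iso[of n] by (simp add: algebra_simps)
    then have "M i - M 0 = e * (L i - L 0)" if "i \<le> Suc n" for i
      using that iso[of i] by (cases "i = Suc n") simp_all
    then show ?thesis using e by blast
  qed
qed

text \<open>An isometry \<open>e * x + c\<close> carries the first half of the walk to the second. A
  translation with \<open>c \<noteq> 0\<close> would give a square in \<open>marked\<close>, since
  the first half covers \<open>|c|\<close> consecutive levels. A reflection would give a palindrome
  around its centre, unless the walk stays on one level.\<close>

lemma marked_walk_repetition:
  fixes L :: "nat \<Rightarrow> int"
  assumes step: "\<And>i. Suc i < 2 * t \<Longrightarrow> \<bar>L (Suc i) - L i\<bar> \<le> 1"
    and rep: "\<And>i. i < t \<Longrightarrow> marked (L i) = marked (L (i + t))"
    and "i < t"
  shows "L (i + t) = L i"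
proof -
  have "t > 0" using \<open>i < t\<close> by simp
  have stepL: "\<bar>L (Suc j) - L j\<bar> \<le> 1" if "j < t - 1" for j
    using step[of j] that by simp
  have "\<exists>e\<in>{1, -1}. \<forall>j\<le>t - 1. L (j + t) - L (0 + t) = e * (L j - L 0)"
    using marked_walk_isometry[of "t - 1" L "\<lambda>j. L (j + t)"] step rep \<open>t > 0\<close> by force
  then obtain e where e: "e = 1 \<or> e = -1"
    and iso: "\<And>j. j < t \<Longrightarrow> L (j + t) - L t = e * (L j - L 0)"
    by (metis Suc_diff_1 \<open>t > 0\<close> add_0 insertE less_Suc_eq_le singletonD)
  define c where "c = L t - e * L 0"
  have im: "L (j + t) = e * L j + c" if "j < t" for j
    using iso[OF that] by (simp add: c_def algebra_simps)
  have mid: "\<bar>L t - L (t - 1)\<bar> \<le> 1"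
    using step[of "t - 1"] \<open>t > 0\<close> by simp
  have visit: "marked k = marked (e * k + c)"
    if range: "a < t" "b < t" "L a \<le> k" "k \<le> L b" for a b k
  proof -
    obtain j where "j \<le> t - 1" "L j = k"
      by (rule walk_intermediate_value[of "t - 1" L a b k]) (use stepL range in auto)
    then show ?thesis using rep[of j] im[of j] \<open>t > 0\<close> by simp
  qed
  from e show ?thesis
  proof
    assume e: "e = 1"
    have "\<not> c > 0"
    proof
      assume c: "c > 0"
      obtain k where k: "L 0 \<le> k" "k < L 0 + c" "marked k \<noteq> marked (k + c)"
        using square_free_seqD[OF square_free_marked c, of "L 0"] .
      have "k \<le> L (t - 1)" using k mid e by (simp add: c_def)
      then show False using visit[of 0 "t - 1" k] k e \<open>t > 0\<close> by simp
    qed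
    moreover have "\<not> c < 0"
    proof
      assume c: "c < 0"
      then have "- c > 0" by simp
      \<comment> \<open>The block starts where it does so that \<open>k - c\<close> runs from
        \<open>L t + 1\<close> to \<open>L 0\<close>, levels that the first half meets.\<close>
      then obtain k where k: "L 0 + 2 * c + 1 \<le> k" "k < L 0 + 2 * c + 1 + - c"
          "marked k \<noteq> marked (k + - c)"
        using square_free_seqD[OF square_free_marked, of "- c" "L 0 + 2 * c + 1"] by blast
      have "L (t - 1) \<le> k - c" using k mid e by (simp add: c_def)
      then show False using visit[of "t - 1" 0 "k - c"] k e \<open>t > 0\<close> by simp
    qed
    ultimately show ?thesis using im[OF \<open>i < t\<close>] e by simp
  next
    assume e: "e = -1"
    then have c: "c = L t + L 0" by (simp add: c_def)
    have turn: "k = c - k" if "a < t" "b < t" "L a \<le> k" "k \<le> L b" "\<bar>2 * k - c\<bar> \<le> 2" for a b k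
      using visit[OF that(1-4)] that(5) e by (intro marked_neighbours) auto
    consider "L t = L 0" | "L t > L 0" | "L t < L 0" by linarith
    then show ?thesis
    proof cases
      case 1
      have "L i = L 0"
      proof (rule ccontr)
        assume "L i \<noteq> L 0"
        then consider "L i > L 0" | "L i < L 0" by linarith
        then show False
          by cases (use turn[of 0 i "L 0 + 1"] turn[of i 0 "L 0 - 1"] 1 c assms(3) in auto)
      qed
      then show ?thesis using im[OF \<open>i < t\<close>] 1 c e by simp
    next
      case 2
      \<comment> \<open>The largest level below the mirror centre \<open>c / 2\<close>; its mirror
        image \<open>c - k\<close> is another level at distance at most 2.\<close>
      define k where "k = (c - 1) div 2"
      have k: "L 0 \<le> k" "k \<le> L t - 1" "k \<noteq> c - k" "\<bar>2 * k - c\<bar> \<le> 2"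
        using 2 unfolding k_def c by presburger+
      then have "k \<le> L (t - 1)" using mid by linarith
      then show ?thesis using turn[of 0 "t - 1" k] k \<open>t > 0\<close> by linarith
    next
      case 3
      \<comment> \<open>Symmetrically, the least level above the centre.\<close>
      define k where "k = c div 2 + 1"
      have k: "k \<le> L 0" "L t + 1 \<le> k" "k \<noteq> c - k" "\<bar>2 * k - c\<bar> \<le> 2"
        using 3 unfolding k_def c by presburger+
      then have "L (t - 1) \<le> k" using mid by linarith
      then show ?thesis using turn[of "t - 1" 0 k] k \<open>t > 0\<close> by linarith
    qed
  qed
qed

section \<open>Layered words and their colouring\<close>

text \<open>A letter is a pair of its level and its index.\<close>

definition linked :: "int \<times> int \<Rightarrow> int \<times> int \<Rightarrow> bool" where
  "linked a b \<longleftrightarrow> \<bar>fst b - fst a\<bar> \<le> 1 \<and> (fst a = fst b \<longrightarrow> snd b = snd a + 1)"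

text \<open>All thresholds \<open>d\<close> are needed because the lowest level of a factor is not
  known in advance. At that threshold only its lowest letters remain, and \<open>linked\<close>
  makes their indices consecutive.\<close>

definition layered :: "(int \<times> int) list \<Rightarrow> bool" where
  "layered W \<longleftrightarrow> (\<forall>d. successively linked (filter (\<lambda>a. fst a \<le> d) W))"

definition colour :: "int \<times> int \<Rightarrow> nat" where
  "colour a = 3 * marked (fst a) + ternary (snd a)"

lemma colour_less: "colour a < 12"
  using marked_less[of "fst a"] ternary_less[of "snd a"] by (simp add: colour_def)

lemma colour_eqD:
  assumes "colour a = colour b"
  shows "marked (fst a) = marked (fst b)" "ternary (snd a) = ternary (snd b)"
proof -
  have "marked (fst a) = colour a div 3" "ternary (snd a) = colour a mod 3" for a
    using ternary_less[of "snd a"] by (simp_all add: colour_def)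
  then show "marked (fst a) = marked (fst b)" "ternary (snd a) = ternary (snd b)"
    using assms by simp_all
qed

lemma layered_appendD:
  assumes "layered (U @ W)"
  shows "layered U" "layered W"
  using assms by (auto simp: layered_def successively_append_iff)

text \<open>At the highest level of the word the filter keeps every letter.\<close>

lemma layered_imp_linked:
  assumes "layered W"
  shows "successively linked W"
proof -
  have "filter (\<lambda>a. fst a \<le> Max (fst ` set W)) W = W"
    by (simp add: filter_id_conv)
  then show ?thesis using assms unfolding layered_def by metis
qed

lemma layered_no_square:
  assumes lay: "layered (X @ Y)" and "X \<noteq> []" and col: "map colour X = map colour Y"
  shows False
proof -
  define t where "t = length X"
  define L where "L = (\<lambda>i. fst ((X @ Y) ! i))"
  have len: "length Y = t" using map_eq_imp_length_eq[OF col] by (simp add: t_def)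
  have coli: "colour (X ! i) = colour (Y ! i)" if "i < t" for i
    using arg_cong[OF col, of "\<lambda>xs. xs ! i"] that len by (simp add: t_def)
  have L: "L i = fst (X ! i)" "L (i + t) = fst (Y ! i)" if "i < t" for i
    using that by (simp_all add: L_def t_def nth_append)
  have "\<bar>L (Suc i) - L i\<bar> \<le> 1" if "Suc i < 2 * t" for i
    using layered_imp_linked[OF lay] that len
    by (auto simp: successively_conv_nth linked_def L_def t_def)
  moreover have "marked (L i) = marked (L (i + t))" if "i < t" for i
    using colour_eqD(1)[OF coli[OF that]] L[OF that] by simp
  ultimately have "L (i + t) = L i" if "i < t" for i
    using marked_walk_repetition that by blast
  then have all2: "list_all2 (\<lambda>a b. fst a = fst b \<and> colour a = colour b) X Y"
    using len L coli by (auto simp: list_all2_conv_all_nth t_def)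
  define d where "d = Min (fst ` set X)"
  define G H where "G = filter (\<lambda>a. fst a \<le> d) X" and "H = filter (\<lambda>a. fst a \<le> d) Y"
  have "set (map fst Y) = set (map fst X)"
    using all2 by (intro arg_cong[of _ _ set]) (auto simp: list_all2_conv_all_nth intro: nth_equalityI)
  then have "fst ` set Y = fst ` set X" by simp
  then have lower: "d \<le> fst a" if "a \<in> set X \<or> a \<in> set Y" for a
    using that unfolding d_def by (intro Min_le) auto
  have lev: "fst a = d" if "a \<in> set (G @ H)" for a
  proof (rule antisym)
    show "fst a \<le> d" using that by (auto simp: G_def H_def)
    show "d \<le> fst a" using that by (intro lower) (auto simp: G_def H_def)
  qed
  have "d \<in> fst ` set X" using \<open>X \<noteq> []\<close> unfolding d_def by (intro Min_in) auto
  then have "G \<noteq> []" by (force simp: G_def filter_empty_conv)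
  define n where "n = length G"
  have "n > 0" using \<open>G \<noteq> []\<close> by (simp add: n_def)
  \<comment> \<open>Since levels agree position by position, the filter selects the same positions
    in both halves, so \<open>G\<close> and \<open>H\<close> match in length and colours.\<close>
  from all2 have "list_all2 (\<lambda>a b. fst a = fst b \<and> colour a = colour b) G H"
    unfolding G_def H_def by (induction rule: list_all2_induct) auto
  then have lenH: "length H = n" and GH: "\<And>i. i < n \<Longrightarrow> colour (G ! i) = colour (H ! i)"
    by (auto simp: list_all2_conv_all_nth n_def)
  have succ: "successively linked (G @ H)"
    using lay by (simp add: layered_def G_def H_def)
  have index: "snd ((G @ H) ! i) = snd (hd G) + int i" if "i < 2 * n" for i
    using that
  proof (induction i)
    case 0
    then show ?case using \<open>n > 0\<close> by (simp add: nth_append n_def hd_conv_nth)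
  next
    case (Suc i)
    have "i < length (G @ H)" "Suc i < length (G @ H)" using Suc.prems lenH n_def by auto
    then have "fst ((G @ H) ! i) = d" "fst ((G @ H) ! Suc i) = d"
      "linked ((G @ H) ! i) ((G @ H) ! Suc i)"
      using lev nth_mem succ by (blast, blast, simp add: successively_conv_nth)
    then show ?case using Suc by (simp add: linked_def)
  qed
  obtain k where k: "snd (hd G) \<le> k" "k < snd (hd G) + int n"
      "ternary k \<noteq> ternary (k + int n)"
    using square_free_seqD[OF square_free_ternary, of "int n" "snd (hd G)"] \<open>n > 0\<close> by auto
  define i where "i = nat (k - snd (hd G))"
  have i: "i < n" "k = snd (hd G) + int i" using k by (auto simp: i_def)
  have "snd (G ! i) = k" "snd (H ! i) = k + int n"
    using index[of i] index[of "i + n"] i by (auto simp: nth_append n_def)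
  then show False using colour_eqD(2)[OF GH[OF i(1)]] k(3) by simp
qed

lemma square_free_colour:
  assumes "layered W"
  shows "square_free (map colour W)"
  unfolding square_free_def
proof safe
  fix u x v
  assume "x \<noteq> []" "map colour W = u @ x @ x @ v"
  then obtain U W1 where 1: "W = U @ W1" "map colour W1 = x @ x @ v"
    by (metis map_eq_append_conv)
  then obtain X W2 where 2: "W1 = X @ W2" "map colour X = x" "map colour W2 = x @ v"
    by (metis map_eq_append_conv)
  then obtain Y V where 3: "W2 = Y @ V" "map colour Y = x"
    by (metis map_eq_append_conv)
  have "layered (U @ (X @ Y) @ V)" using assms 1 2 3 by simp
  then have "layered (X @ Y)" using layered_appendD by blast
  then show False
    using layered_no_square[of X Y] \<open>x \<noteq> []\<close> 2 3 by auto
qed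

section \<open>Insertion of a letter into a layered word\<close>

text \<open>A new layer may start at any index, here 0. Prolonging a layer to the left produces
  negative indices, hence the two-sided sequences.\<close>

definition between :: "int \<times> int \<Rightarrow> int \<times> int \<Rightarrow> int \<times> int" where
  "between a b =
     (if fst a = fst b then (fst a + 1, 0)
      else if fst a < fst b then (fst b, snd b - 1)
      else (fst a, snd a + 1))"

text \<open>The new letter is at least as high as both neighbours. If it survives a filter, so do
  they, and only its links to them have to be checked; otherwise the filtered word is
  unchanged.\<close>

lemma layered_insert_between:
  assumes "layered (U @ a # b # V)"
  shows "layered (U @ a # between a b # b # V)"
  unfolding layered_def
proof
  fix d
  let ?c = "between a b"
  have "successively linked (U @ a # b # V)"
    using assms by (rule layered_imp_linked)
  then have "linked a b" by (simp add: successively_append_iff)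
  then have c: "linked a ?c" "linked ?c b" "fst a \<le> fst ?c" "fst b \<le> fst ?c"
    by (auto simp: linked_def between_def)
  have "successively linked (filter (\<lambda>x. fst x \<le> d) (U @ a # b # V))"
    using assms by (simp add: layered_def)
  then show "successively linked (filter (\<lambda>x. fst x \<le> d) (U @ a # ?c # b # V))"
    using c by (auto simp: successively_append_iff successively_Cons)
qed

text \<open>The two markers are virtual neighbours of the end letters.\<close>

definition framed :: "(int \<times> int) list \<Rightarrow> (int \<times> int) list" where
  "framed W = (0, 0) # W @ [(0, 1)]"

text \<open>The frame shifts positions by one, so entries \<open>i\<close> and \<open>Suc i\<close>
  of \<open>framed W\<close> enclose gap \<open>i\<close> of \<open>W\<close>.\<close>

definition insert_between :: "nat \<Rightarrow> (int \<times> int) list \<Rightarrow> (int \<times> int) list" where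
  "insert_between i W = ext_at W i (between (framed W ! i) (framed W ! Suc i))"

lemma layered_insert_between_framed:
  assumes "layered (framed W)" "i \<le> length W"
  shows "layered (framed (insert_between i W))"
proof -
  let ?a = "framed W ! i" and ?b = "framed W ! Suc i"
  have len: "i < length (framed W)" "Suc i < length (framed W)"
    using assms(2) by (simp_all add: framed_def)
  have split: "drop i (framed W) = ?a # ?b # drop (Suc (Suc i)) (framed W)"
    using len by (simp only: Cons_nth_drop_Suc)
  have "framed (insert_between i W) =
      take (Suc i) (framed W) @ between ?a ?b # drop (Suc i) (framed W)"
    using assms(2) by (simp add: framed_def insert_between_def ext_at_def)
  also have "\<dots> = take i (framed W) @ ?a # between ?a ?b # ?b # drop (Suc (Suc i)) (framed W)"
    using len by (simp only: take_Suc_conv_app_nth Cons_nth_drop_Suc append_assoc append.simps)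
  finally show ?thesis
    using layered_insert_between[of "take i (framed W)" ?a ?b] assms(1)
    by (metis split append_take_drop_id)
qed

section \<open>The complete tree\<close>

definition node :: "nat list \<Rightarrow> (int \<times> int) list" where
  "node p = fold insert_between p []"

lemma node_snoc: "node (p @ [i]) = insert_between i (node p)"
  by (simp add: node_def)

lemma length_insert_between: "i \<le> length W \<Longrightarrow> length (insert_between i W) = Suc (length W)"
  by (simp add: insert_between_def ext_at_def)

text \<open>The length belongs to the induction because insertion needs
  \<open>i \<le> length W\<close>, while a valid path bounds \<open>i\<close> by the number of
  earlier steps.\<close>

lemma layered_node:
  assumes "valid_path 0 p"
  shows "length (node p) = length p \<and> layered (framed (node p))"
  using assms
proof (induction p rule: rev_induct)
  case Nil
  \<comment> \<open>The frame of the empty word is linked because its two letters have consecutive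
    indices 0 and 1.\<close>
  then show ?case by (simp add: node_def framed_def layered_def linked_def)
next
  case (snoc i p)
  have "valid_path 0 p" "i \<le> length p"
    using snoc.prems by (auto simp: valid_path_def nth_append less_Suc_eq split: if_splits)
  then show ?case
    using snoc.IH by (simp add: node_snoc length_insert_between layered_insert_between_framed)
qed

lemma square_free_framed:
  assumes "layered (framed W)"
  shows "square_free (map colour W)"
  using assms layered_appendD[of "[(0, 0)]"] layered_appendD(1)[of W]
  by (auto simp: framed_def intro: square_free_colour)

lemma colour_insert_between:
  "\<exists>c<12. map colour (insert_between i W) = ext_at (map colour W) i c"
  by (auto simp: insert_between_def ext_at_def take_map drop_map intro: colour_less)

theorem mainTheorem5:
  shows "\<exists>(A :: nat set) (T :: nat list \<Rightarrow> nat list). card A = 12 \<and> complete_bifurcate_tree A T"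
proof (intro exI conjI)
  let ?T = "\<lambda>p. map colour (node p)"
  show "card {..<12::nat} = 12" by simp
  have root: "length (?T []) = 0" by (simp add: node_def)
  show "complete_bifurcate_tree {..<12} ?T"
    unfolding complete_bifurcate_tree_def root
  proof (intro conjI allI impI)
    fix p assume "valid_path 0 p"
    then have p: "layered (framed (node p))" using layered_node by blast
    \<comment> \<open>The square-free extension at position \<open>i\<close> is the child of the
      node in that direction.\<close>
    have "\<exists>c\<in>{..<12}. square_free (ext_at (?T p) i c)" if "i \<le> length (?T p)" for i
      using square_free_framed[OF layered_insert_between_framed[OF p, of i]]
        colour_insert_between[of i "node p"] that by auto
    then show "bifurcate {..<12} (?T p)"
      using square_free_framed[OF p] colour_less by (auto simp: bifurcate_def)
  next
    fix p i
    show "\<exists>c\<in>{..<12}. ?T (p @ [i]) = ext_at (?T p) i c"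
      using colour_insert_between[of i "node p"] by (auto simp: node_snoc)
  qed
qed

end
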